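(* For each integer $n\ge 2$ write $N=n-1$, and let $\widehat p_n$ and $\varphi$ be the probability densities on $\mathbb{R}$ defined in the context. Define $$\widehat Q(z):=-\frac14\bigl(z^4-6z^2+3\bigr)\varphi(z),\qquad z\in\mathbb{R}.$$ Then, as $n\to\infty$, $$N(\widehat p_n-\varphi)\longrightarrow\widehat Q\qquad\text{in }L^1(\mathbb{R}).$$
   Context: $\varphi(z)=(2\pi)^{-1/2}e^{-z^2/2}$ is the standard Gaussian density on $\mathbb{R}$. For $n\ge2$ and $N=n-1$, let $$h_N(y)=\begin{cases}\left(1-\frac{y^2}{N}\right)^{N/2}, & |y|\le\sqrt N,\\ 0,& |y|>\sqrt N,\end{cases}\qquad D_N=\int_{\mathbb{R}}h_N(y)\,dy,\qquad p_n(y)=\frac{h_N(y)}{D_N},$$ and $$\kappa_n=\sqrt{\frac{N}{N+3}},\qquad \widehat p_n(z)=\kappa_n\,p_n(\kappa_n z),\quad z\in\mathbb{R}.$$ (The density $\widehat p_n$ is that of $\theta/\sigma_n$, where $\theta$ has density proportional to $(1-4\theta^2/\pi^2)^{N/2}$ on $[-\pi/2,\pi/2]$ and $\sigma_n^2=\pi^2/(4(N+3))$ is its variance.) *)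

theory Defs
  imports "HOL-Probability.Probability"
begin

(* The standard Gaussian density is the library's std_normal_density = normal_density 0 1. *)

definition h_profile :: "nat \<Rightarrow> real \<Rightarrow> real" where
  "h_profile N y =
     (if \<bar>y\<bar> \<le> sqrt (real N) then (1 - y\<^sup>2 / real N) powr (real N / 2) else 0)"

definition D_const :: "nat \<Rightarrow> real" where
  "D_const N = (\<integral>y. h_profile N y \<partial>lborel)"

(* The next three definitions are indexed by n, with N = n - 1. They are meant for n \<ge> 2 only;
   the values at n = 0 and n = 1 carry no meaning. *)

definition p_dens :: "nat \<Rightarrow> real \<Rightarrow> real" where
  "p_dens n y = h_profile (n - 1) y / D_const (n - 1)"

definition kappa :: "nat \<Rightarrow> real" where
  "kappa n = sqrt (real (n - 1) / (real (n - 1) + 3))"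

definition p_hat :: "nat \<Rightarrow> real \<Rightarrow> real" where
  "p_hat n z = kappa n * p_dens n (kappa n * z)"

definition Q_hat :: "real \<Rightarrow> real" where
  "Q_hat z = - (1 / 4) * (z ^ 4 - 6 * z\<^sup>2 + 3) * std_normal_density z"

(* Convergence in L^1(M) of the terms f n, n \<ge> m. Integrability is required explicitly
   because the Bochner integral of a non-integrable function is 0 by convention. *)

definition converges_L1_from :: "'a measure \<Rightarrow> nat \<Rightarrow> (nat \<Rightarrow> 'a \<Rightarrow> real) \<Rightarrow> ('a \<Rightarrow> real) \<Rightarrow> bool" where
  "converges_L1_from M m f g \<longleftrightarrow>
     (\<forall>n\<ge>m. integrable M (f n)) \<and> integrable M g \<and>
     (\<lambda>n. \<integral>x. \<bar>f n x - g x\<bar> \<partial>M) \<longlonglongrightarrow> 0"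

end

theory Submission
  imports Defs "HOL-Real_Asymp.Real_Asymp"
begin

text \<open>
  Up to normalisation, \<open>p_hat (N + 1)\<close> is \<open>g(z) = (1 - z\<^sup>2 / (N + 3))\<^sub>+ powr (N / 2)\<close>. Expanding the
  logarithm gives \<open>N (g - exp (- z\<^sup>2 / 2)) \<rightarrow> (3/2 z\<^sup>2 - z^4 / 4) exp (- z\<^sup>2 / 2)\<close> pointwise, and the
  left-hand side is dominated by \<open>(2 z\<^sup>2 + z^4) exp (- z\<^sup>2 / 8)\<close>. Integrating this limit yields the
  first-order correction \<open>3/4 sqrt (2 pi)\<close> of the normalising constant, so no Gamma function
  asymptotics are needed, and dividing by that constant gives the result by dominated convergence.
\<close>

section \<open>The rescaled profile and Gaussian preliminaries\<close>

text \<open>Since \<open>0 powr a = 0\<close>, the \<open>max 0\<close> encodes the cutoff of the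
  support. The denominator N + 3 is what the rescaling by \<open>kappa\<close> makes of N.\<close>

definition bump :: "nat \<Rightarrow> real \<Rightarrow> real" where
  "bump N z = max 0 (1 - z\<^sup>2 / (real N + 3)) powr (real N / 2)"

lemma bump_measurable [measurable]: "bump N \<in> borel_measurable borel"
  unfolding bump_def by measurable

lemma gauss_eq: "exp (- z\<^sup>2 / 2) = sqrt (2 * pi) * std_normal_density z"
  by (simp add: normal_density_def)

lemma gauss_powers_integrable:
  assumes "c > 0"
  shows "integrable lborel (\<lambda>z::real. z ^ k * exp (- z\<^sup>2 / c))"
proof -
  \<comment> \<open>Variance c / 2 turns the weight into a multiple of a normal density, whose
    moments are known to be integrable.\<close>
  define s where "s = sqrt (c / 2)"
  have s: "s > 0" "2 * s\<^sup>2 = c" using assms by (auto simp: s_def)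
  have "integrable lborel (\<lambda>z. sqrt (2 * pi * s\<^sup>2) * (normal_density 0 s z * (z - 0) ^ k))"
    using s by (intro integrable_mult_right integrable_normal_moment)
  also have "(\<lambda>z. sqrt (2 * pi * s\<^sup>2) * (normal_density 0 s z * (z - 0) ^ k))
      = (\<lambda>z. z ^ k * exp (- z\<^sup>2 / c))"
    using s by (auto simp: normal_density_def fun_eq_iff)
  finally show ?thesis .
qed

text \<open>A mean value estimate: the derivative of exp between a and b is at most exp m. It
  transfers a common Gaussian bound on the exponents to the difference of the exponentials.\<close>

lemma exp_diff_le:
  fixes a b m :: real
  assumes "a \<le> m" "b \<le> m"
  shows "\<bar>exp a - exp b\<bar> \<le> \<bar>a - b\<bar> * exp m"
proof -
  have *: "exp y - exp x \<le> (y - x) * exp m" if "x \<le> y" "y \<le> m" for x y :: real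
  proof -
    have "1 - (y - x) \<le> exp (x - y)" using exp_ge_add_one_self[of "x - y"] by linarith
    then have "exp y * (1 - exp (x - y)) \<le> exp y * (y - x)"
      by (intro mult_left_mono) auto
    also have "\<dots> \<le> exp m * (y - x)"
      using that by (intro mult_right_mono) auto
    finally show ?thesis by (simp add: algebra_simps flip: exp_add)
  qed
  show ?thesis
    using *[of a b] *[of b a] assms by (cases "a \<le> b") auto
qed

section \<open>Domination and pointwise expansion of the profile\<close>

lemma bump_bound:
  "\<bar>real N * (bump N z - exp (- z\<^sup>2 / 2))\<bar> \<le> (2 * z\<^sup>2 + z ^ 4) * exp (- z\<^sup>2 / 8)"
proof (cases "N = 0")
  case True
  then show ?thesis by simp
next
  case False
  define M where "M = real N + 3"
  define x where "x = z\<^sup>2 / M"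
  \<comment> \<open>\<open>4 * real N \<ge> M\<close> amounts to N \<ge> 1. It gives N x / 2 \<ge>
    z^2 / 8, the source of the 8 in the bound.\<close>
  have M: "M > 0" "real N \<le> M" "4 * real N \<ge> M" "M = real N + 3" using False by (auto simp: M_def)
  have x: "x \<ge> 0" "z\<^sup>2 = M * x" using M by (auto simp: x_def)
  have z4: "z ^ 4 = (M * x)\<^sup>2" using x(2) by (metis power2_eq_square power4_eq_xxxx mult.assoc)
  have Nx: "real N * x \<ge> M * x / 4" using mult_right_mono[OF M(3) x(1)] by simp
  have bump: "bump N z = max 0 (1 - x) powr (real N / 2)"
    by (simp add: bump_def x_def M_def)
  show ?thesis
  \<comment> \<open>For x \<le> 1/2 the logarithm is controlled to second order. For x > 1/2 the
    factor N is itself below 2 z^2, so a crude bound on the difference suffices.\<close>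
  proof (cases "x \<le> 1 / 2")
    case True
    define a where "a = real N / 2 * ln (1 - x)"
    have eqa: "bump N z = exp a"
      using True by (simp add: bump a_def powr_def max_def)
    have "ln (1 - x) \<le> - x" using ln_le_minus_one[of "1 - x"] True by simp
    then have "a \<le> real N / 2 * (- x)" unfolding a_def by (intro mult_left_mono) auto
    then have a_le: "a \<le> - z\<^sup>2 / 8" using Nx x by simp
    have ln: "\<bar>ln (1 - x) + x\<bar> \<le> 2 * x\<^sup>2"
      using abs_ln_one_plus_x_minus_x_bound[of "- x"] True x by simp
    \<comment> \<open>As z^2 / 2 = (N + 3) x / 2, the shift by 3 leaves the term 3/2 x.\<close>
    have "a - (- z\<^sup>2 / 2) = real N / 2 * (ln (1 - x) + x) + 3 / 2 * x"
      using x M by (simp add: a_def field_simps)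
    also have "\<bar>\<dots>\<bar> \<le> real N / 2 * (2 * x\<^sup>2) + 3 / 2 * x"
      using x mult_left_mono[OF ln, of "real N / 2"]
      by (intro order_trans[OF abs_triangle_ineq] add_mono) (simp_all add: abs_mult)
    finally have ab: "\<bar>a - (- z\<^sup>2 / 2)\<bar> \<le> real N * x\<^sup>2 + 3 / 2 * x" by simp
    have "real N * \<bar>a - (- z\<^sup>2 / 2)\<bar> \<le> real N * (real N * x\<^sup>2 + 3 / 2 * x)"
      using ab by (intro mult_left_mono) auto
    also have "\<dots> = (real N * x)\<^sup>2 + 3 / 2 * (real N * x)"
      by (simp add: power2_eq_square algebra_simps)
    also have "\<dots> \<le> (M * x)\<^sup>2 + 2 * (M * x)"
      using M x by (intro add_mono power_mono mult_mono) auto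
    finally have c: "real N * \<bar>a - (- z\<^sup>2 / 2)\<bar> \<le> 2 * z\<^sup>2 + z ^ 4" using x z4 by simp
    have "\<bar>real N * (bump N z - exp (- z\<^sup>2 / 2))\<bar> = real N * \<bar>exp a - exp (- z\<^sup>2 / 2)\<bar>"
      by (simp add: eqa abs_mult)
    also have "\<dots> \<le> real N * (\<bar>a - (- z\<^sup>2 / 2)\<bar> * exp (- z\<^sup>2 / 8))"
      using a_le by (intro mult_left_mono exp_diff_le) auto
    also have "\<dots> \<le> (2 * z\<^sup>2 + z ^ 4) * exp (- z\<^sup>2 / 8)"
      using c unfolding mult.assoc[symmetric] by (intro mult_right_mono) auto
    finally show ?thesis .
  next
    case x_gt: False
    \<comment> \<open>This holds beyond the support as well, so x > 1 needs no separate
      case.\<close>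
    have "max 0 (1 - x) \<le> exp (- x)" using exp_ge_add_one_self[of "- x"] by simp
    then have "bump N z \<le> exp (- x) powr (real N / 2)"
      unfolding bump by (intro powr_mono2) auto
    also have "\<dots> = exp (- (real N * x / 2))" by (simp add: powr_def)
    also have "\<dots> \<le> exp (- z\<^sup>2 / 8)" using Nx x by simp
    finally have u: "bump N z \<le> exp (- z\<^sup>2 / 8)" .
    have "0 \<le> bump N z" by (simp add: bump_def)
    moreover have "exp (- z\<^sup>2 / 2) \<le> exp (- z\<^sup>2 / 8)" by simp
    moreover have "0 \<le> exp (- z\<^sup>2 / 2)" by simp
    ultimately have d: "\<bar>bump N z - exp (- z\<^sup>2 / 2)\<bar> \<le> exp (- z\<^sup>2 / 8)"
      using u by linarith
    have "real N \<le> 2 * z\<^sup>2"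
      using mult_strict_left_mono[of "1/2" x M] x_gt M(1,2) x(2) by linarith
    then have "real N \<le> 2 * z\<^sup>2 + z ^ 4" by (smt (verit) zero_le_even_power even_numeral)
    then show ?thesis unfolding abs_mult using d by (intro mult_mono) auto
  qed
qed

lemma bump_pointwise:
  "(\<lambda>N. real N * (bump N z - exp (- z\<^sup>2 / 2))) \<longlonglongrightarrow> (3 / 2 * z\<^sup>2 - z ^ 4 / 4) * exp (- z\<^sup>2 / 2)"
proof (cases "z = 0")
  case True
  then show ?thesis by (simp add: bump_def)
next
  case False
  define w where "w = z\<^sup>2"
  have w: "w > 0" using False by (simp add: w_def)
  \<comment> \<open>Here N is a real variable and the cutoff is dropped; the base is nonnegative as
    soon as N \<ge> w.\<close>
  have "((\<lambda>N. N * ((1 - w / (N + 3)) powr (N / 2) - exp (- w / 2))) \<longlongrightarrow>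
      exp (- (w / 2)) * (w * 3 - w * w / 2) / 2) at_top"
    using w by real_asymp
  also have "exp (- (w / 2)) * (w * 3 - w * w / 2) / 2 = (3 / 2 * w - w\<^sup>2 / 4) * exp (- w / 2)"
    by (simp add: power2_eq_square field_simps)
  finally have "(\<lambda>N. real N * ((1 - w / (real N + 3)) powr (real N / 2) - exp (- w / 2)))
      \<longlonglongrightarrow> (3 / 2 * w - w\<^sup>2 / 4) * exp (- w / 2)"
    by (rule filterlim_compose[OF _ filterlim_real_sequentially])
  moreover have "\<forall>\<^sub>F N in sequentially.
      real N * ((1 - w / (real N + 3)) powr (real N / 2) - exp (- w / 2))
      = real N * (bump N z - exp (- z\<^sup>2 / 2))"
    using eventually_ge_at_top[of "nat \<lceil>w\<rceil>"]
  proof eventually_elim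
    case (elim N)
    then have "w \<le> real N + 3" by linarith
    then show ?case by (simp add: bump_def w_def max_def)
  qed
  ultimately show ?thesis
    unfolding w_def power_mult[symmetric] by (auto elim: Lim_transform_eventually)
qed

lemma bump_dominating_integrable:
  "integrable lborel (\<lambda>z::real. (2 * z\<^sup>2 + z ^ 4) * exp (- z\<^sup>2 / 8))"
proof -
  have "integrable lborel (\<lambda>z::real. 2 * (z\<^sup>2 * exp (- z\<^sup>2 / 8)) + z ^ 4 * exp (- z\<^sup>2 / 8))"
    by (intro Bochner_Integration.integrable_add integrable_mult_right gauss_powers_integrable) auto
  then show ?thesis by (simp add: algebra_simps)
qed

text \<open>The domination bound makes N times the difference from the Gaussian integrable; N > 0
  allows the factor to be cancelled.\<close>

lemma bump_integrable:
  assumes "N > 0"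
  shows "integrable lborel (bump N)"
proof -
  have "integrable lborel (\<lambda>z. real N * (bump N z - exp (- z\<^sup>2 / 2)))"
    by (rule Bochner_Integration.integrable_bound[OF bump_dominating_integrable])
      (use order_trans[OF bump_bound abs_ge_self] in auto)
  then have "integrable lborel (\<lambda>z. bump N z - exp (- z\<^sup>2 / 2))"
    using assms by simp
  from Bochner_Integration.integrable_add[OF this gauss_powers_integrable[of 2 0]]
  show ?thesis by simp
qed

section \<open>First-order expansion of the normalising constant\<close>

definition bump_integral :: "nat \<Rightarrow> real" where
  "bump_integral N = (\<integral>z. bump N z \<partial>lborel)"

lemma bump_integral_limit:
  "(\<lambda>N. real N * (bump_integral N - sqrt (2 * pi))) \<longlonglongrightarrow> 3 / 4 * sqrt (2 * pi)"
proof -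
  have "(\<lambda>N. \<integral>z. real N * (bump N z - exp (- z\<^sup>2 / 2)) \<partial>lborel)
      \<longlonglongrightarrow> (\<integral>z. (3 / 2 * z\<^sup>2 - z ^ 4 / 4) * exp (- z\<^sup>2 / 2) \<partial>lborel)"
    by (rule integral_dominated_convergence[OF _ _ bump_dominating_integrable])
      (use bump_bound bump_pointwise in auto)
  moreover have "(\<integral>z. real N * (bump N z - exp (- z\<^sup>2 / 2)) \<partial>lborel)
      = real N * (bump_integral N - sqrt (2 * pi))" for N
  proof (cases "N = 0")
    case False
    then show ?thesis
      using bump_integrable[of N] unfolding gauss_eq
      by (simp add: bump_integral_def Bochner_Integration.integral_diff)
  qed simp
  moreover have "(\<integral>z. (3 / 2 * z\<^sup>2 - z ^ 4 / 4) * exp (- z\<^sup>2 / 2) \<partial>lborel) = 3 / 4 * sqrt (2 * pi)"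
  proof -
    have m2: "has_bochner_integral lborel (\<lambda>z. std_normal_density z * z ^ 2) 1"
      using std_normal_moment_even[of 1] by simp
    have m4: "has_bochner_integral lborel (\<lambda>z. std_normal_density z * z ^ 4) 3"
      using std_normal_moment_even[of 2] by (simp add: fact_numeral)
    \<comment> \<open>The second and fourth Gaussian moments are 1 and 3, and 3/2 - 3/4 =
      3/4.\<close>
    have "has_bochner_integral lborel
        (\<lambda>z. sqrt (2 * pi) * (3 / 2 * (std_normal_density z * z\<^sup>2) - 1 / 4 * (std_normal_density z * z ^ 4)))
        (sqrt (2 * pi) * (3 / 2 * 1 - 1 / 4 * 3))"
      by (intro has_bochner_integral_mult_right has_bochner_integral_diff m2 m4)
    also have "(\<lambda>z. sqrt (2 * pi) * (3 / 2 * (std_normal_density z * z\<^sup>2)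
        - 1 / 4 * (std_normal_density z * z ^ 4))) = (\<lambda>z. (3 / 2 * z\<^sup>2 - z ^ 4 / 4) * exp (- z\<^sup>2 / 2))"
      unfolding gauss_eq by (auto simp: algebra_simps)
    finally show ?thesis
      by (simp add: has_bochner_integral_integral_eq)
  qed
  ultimately show ?thesis by (simp only:)
qed

lemma bump_integral_tendsto: "bump_integral \<longlonglongrightarrow> sqrt (2 * pi)"
proof -
  have "(\<lambda>N. real N * (bump_integral N - sqrt (2 * pi)) * inverse (real N)) \<longlonglongrightarrow> 3 / 4 * sqrt (2 * pi) * 0"
    by (intro tendsto_mult bump_integral_limit lim_inverse_n)
  then have "(\<lambda>N. bump_integral N - sqrt (2 * pi)) \<longlonglongrightarrow> 0"
    unfolding mult_zero_right
    by (rule Lim_transform_eventually) (use eventually_gt_at_top[of 0] in eventually_elim, simp)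
  then show ?thesis by (simp add: LIM_zero_iff)
qed

section \<open>Passage to the normalised densities\<close>

text \<open>Substituting y = k z turns y^2 / N into z^2 / (N + 3), and the Jacobian k in
  \<open>D_const\<close> cancels the prefactor of \<open>p_hat\<close>.\<close>

lemma p_hat_eq_bump:
  assumes "N > 0"
  shows "p_hat (Suc N) z = bump N z / bump_integral N"
proof -
  define k where "k = kappa (Suc N)"
  have k: "k > 0" "k\<^sup>2 = real N / (real N + 3)" using assms by (auto simp: k_def kappa_def)
  have h: "h_profile N (k * z) = bump N z" for z
  proof -
    have eq: "(k * z)\<^sup>2 / real N = z\<^sup>2 / (real N + 3)"
      using assms by (simp add: power_mult_distrib k)
    \<comment> \<open>The support condition is exactly nonnegativity of the base of the
      power.\<close>
    have "\<bar>k * z\<bar> \<le> sqrt (real N) \<longleftrightarrow> (k * z)\<^sup>2 / real N \<le> 1"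
      using assms by (simp add: real_le_rsqrt sqrt_le_D divide_le_eq_1 real_sqrt_le_iff flip: real_sqrt_abs)
    then show ?thesis unfolding h_profile_def bump_def eq by (auto simp: max_def)
  qed
  have "D_const N = \<bar>k\<bar> *\<^sub>R (\<integral>z. h_profile N (0 + k * z) \<partial>lborel)"
    unfolding D_const_def using k by (intro lborel_integral_real_affine) auto
  also have "\<dots> = k * bump_integral N" using k by (simp add: h bump_integral_def)
  finally show ?thesis using k by (simp add: p_hat_def p_dens_def h flip: k_def)
qed

lemma Q_hat_integrable: "integrable lborel Q_hat"
proof -
  have m: "integrable lborel (\<lambda>z. std_normal_density z * (z - 0) ^ k)" for k
    by (rule integrable_normal_moment) simp
  have "integrable lborel (\<lambda>z. - (1 / 4) * (std_normal_density z * (z - 0) ^ 4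
      - 6 * (std_normal_density z * (z - 0) ^ 2) + 3 * (std_normal_density z * (z - 0) ^ 0)))"
    by (intro integrable_mult_right Bochner_Integration.integrable_add
        Bochner_Integration.integrable_diff m)
  also have "(\<lambda>z. - (1 / 4) * (std_normal_density z * (z - 0) ^ 4
      - 6 * (std_normal_density z * (z - 0) ^ 2) + 3 * (std_normal_density z * (z - 0) ^ 0))) = Q_hat"
    by (auto simp: Q_hat_def algebra_simps)
  finally show ?thesis .
qed

text \<open>With I = \<open>bump_integral N\<close>, g the profile and e = exp (- z^2 / 2) = sqrt (2
  pi) phi, one has N (g / I - phi) = N (g - e) / I - (N (I - sqrt (2 pi)) / I) phi. \<open>F\<close>
  is the right-hand side, and both of its terms have known limits.\<close>

lemma p_hat_L1_limit:
  "(\<lambda>N. \<integral>z. \<bar>real N * (p_hat (Suc N) z - std_normal_density z) - Q_hat z\<bar> \<partial>lborel) \<longlonglongrightarrow> 0"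
proof -
  let ?W = "\<lambda>z::real. (2 * z\<^sup>2 + z ^ 4) * exp (- z\<^sup>2 / 8)"
  define r where "r N = inverse (bump_integral N)" for N
  define d where "d N = real N * (bump_integral N - sqrt (2 * pi)) * r N" for N
  define F where "F N z = real N * (bump N z - exp (- z\<^sup>2 / 2)) * r N - d N * std_normal_density z"
    for N z
  have F_meas [measurable]: "F N \<in> borel_measurable borel" for N
    unfolding F_def by measurable
  have Q_meas [measurable]: "Q_hat \<in> borel_measurable borel"
    unfolding Q_hat_def by measurable
  have r: "r \<longlonglongrightarrow> inverse (sqrt (2 * pi))"
    unfolding r_def by (intro tendsto_inverse bump_integral_tendsto) simp
  have "d \<longlonglongrightarrow> 3 / 4 * sqrt (2 * pi) * inverse (sqrt (2 * pi))"
    unfolding d_def by (intro tendsto_mult bump_integral_limit r)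
  then have d: "d \<longlonglongrightarrow> 3 / 4" by (simp add: mult.assoc)
  \<comment> \<open>Convergent sequences are bounded; A and B make the dominating function
    independent of N.\<close>
  obtain A where A: "\<And>N. \<bar>r N\<bar> \<le> A"
    using convergent_imp_Bseq[OF convergentI[OF r]] by (auto simp: Bseq_def)
  obtain B where B: "\<And>N. \<bar>d N\<bar> \<le> B"
    using convergent_imp_Bseq[OF convergentI[OF d]] by (auto simp: Bseq_def)
  have "(\<lambda>N. \<integral>z. \<bar>F N z - Q_hat z\<bar> \<partial>lborel) \<longlonglongrightarrow> (\<integral>z. 0 \<partial>(lborel :: real measure))"
  proof (rule integral_dominated_convergence)
    show "integrable lborel (\<lambda>z. ?W z * A + B * std_normal_density z + \<bar>Q_hat z\<bar>)"
      by (intro Bochner_Integration.integrable_add integrable_mult_left integrable_mult_right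
          integrable_abs bump_dominating_integrable Q_hat_integrable) simp
    show "AE z in lborel. (\<lambda>N. \<bar>F N z - Q_hat z\<bar>) \<longlonglongrightarrow> 0"
    proof (intro AE_I2)
      fix z :: real
      have "(\<lambda>N. F N z) \<longlonglongrightarrow> (3 / 2 * z\<^sup>2 - z ^ 4 / 4) * exp (- z\<^sup>2 / 2) * inverse (sqrt (2 * pi))
          - 3 / 4 * std_normal_density z"
        unfolding F_def by (intro tendsto_diff tendsto_mult bump_pointwise r d tendsto_const)
      \<comment> \<open>Dividing by sqrt (2 pi) turns e into phi, and 3/2 z^2 - z^4 / 4 - 3/4 = -
        (z^4 - 6 z^2 + 3) / 4, a multiple of the fourth Hermite polynomial.\<close>
      also have "(3 / 2 * z\<^sup>2 - z ^ 4 / 4) * exp (- z\<^sup>2 / 2) * inverse (sqrt (2 * pi))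
          - 3 / 4 * std_normal_density z = Q_hat z"
        unfolding gauss_eq by (simp add: Q_hat_def field_simps)
      finally have "(\<lambda>N. \<bar>F N z - Q_hat z\<bar>) \<longlonglongrightarrow> \<bar>Q_hat z - Q_hat z\<bar>"
        by (intro tendsto_intros)
      then show "(\<lambda>N. \<bar>F N z - Q_hat z\<bar>) \<longlonglongrightarrow> 0" by simp
    qed
    show "AE z in lborel. norm \<bar>F N z - Q_hat z\<bar> \<le> ?W z * A + B * std_normal_density z + \<bar>Q_hat z\<bar>"
      for N
    proof (intro AE_I2)
      fix z :: real
      have "\<bar>real N * (bump N z - exp (- z\<^sup>2 / 2)) * r N\<bar> \<le> ?W z * A"
        unfolding abs_mult[of _ "r N"] using bump_bound[of N z] A[of N] by (intro mult_mono) auto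
      moreover have "\<bar>d N * std_normal_density z\<bar> \<le> B * std_normal_density z"
        unfolding abs_mult using B[of N] by (simp add: mult_right_mono)
      ultimately show "norm \<bar>F N z - Q_hat z\<bar> \<le> ?W z * A + B * std_normal_density z + \<bar>Q_hat z\<bar>"
        unfolding F_def by simp
    qed
  qed measurable
  moreover have "\<forall>\<^sub>F N in sequentially. (\<integral>z. \<bar>F N z - Q_hat z\<bar> \<partial>lborel)
      = (\<integral>z. \<bar>real N * (p_hat (Suc N) z - std_normal_density z) - Q_hat z\<bar> \<partial>lborel)"
    \<comment> \<open>The integral is eventually positive because its limit is, so division by it is
      legitimate.\<close>
    using eventually_gt_at_top[of 0] order_tendstoD(1)[OF bump_integral_tendsto, of 0, simplified]
  proof eventually_elim
    case (elim N)
    then have "F N z = real N * (p_hat (Suc N) z - std_normal_density z)" for z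
      unfolding F_def gauss_eq by (simp add: d_def r_def p_hat_eq_bump field_simps)
    then show ?case by simp
  qed
  ultimately show ?thesis by (simp add: tendsto_cong)
qed

theorem theorem5p8:
  shows "converges_L1_from lborel 2
           (\<lambda>n z. real (n - 1) * (p_hat n z - std_normal_density z)) Q_hat"
  unfolding converges_L1_from_def
proof (intro conjI allI impI)
  fix n :: nat
  assume "n \<ge> 2"
  then obtain N where N: "n = Suc N" "N > 0" by (cases n) auto
  then have "p_hat n = (\<lambda>z. bump N z / bump_integral N)"
    by (simp add: p_hat_eq_bump fun_eq_iff)
  then show "integrable lborel (\<lambda>z. real (n - 1) * (p_hat n z - std_normal_density z))"
    using bump_integrable[OF N(2)]
    by (auto intro!: integrable_mult_right Bochner_Integration.integrable_diff integrable_divide)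
next
  show "(\<lambda>n. \<integral>z. \<bar>real (n - 1) * (p_hat n z - std_normal_density z) - Q_hat z\<bar> \<partial>lborel) \<longlonglongrightarrow> 0"
    by (rule LIMSEQ_imp_Suc) (simp add: p_hat_L1_limit)
qed (rule Q_hat_integrable)

end
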